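(* Let $\alpha>0$. Let $X$ and $Y$ be independent, positive, non-Dirac random variables, and set $(U,V)=F^{(\alpha,\infty)}(X,Y)$. If $U$ and $V$ are independent, then there exist constants $a,b,\lambda$ with $b>a>|\lambda|$ such that $$(X,Y)\sim \mathrm{GB}_{II}(\lambda,a,b;\alpha)\otimes \mathrm{B}_{II}(b-a,a+\lambda),$$ and consequently $$(U,V)\sim \mathrm{GB}_{II}(-\lambda,a,b;\alpha)\otimes \mathrm{B}_{II}(b-a,a-\lambda).$$
   Context: For $\alpha>0$ the map $F^{(\alpha,\infty)}\colon(0,\infty)^2\to(0,\infty)^2$ is defined by $$F^{(\alpha,\infty)}(x,y)=\left(\frac{1+y+\alpha xy}{\alpha x},\;\frac{xy(1+\alpha x)}{1+x+y+\alpha xy}\right).$$ For $\gamma>0$, $p,q>0$ and $-q<\nu<p$, the generalized second kind beta distribution $\mathrm{GB}_{II}(\nu,p,q;\gamma)$ is the probability law on $(0,\infty)$ with density proportional to $$\frac{x^{q+\nu-1}}{(1+\gamma x)^{p+\nu}(1+x)^{q-\nu}}\,\mathbf 1_{(0,\infty)}(x).$$ For $c,d>0$, the second kind beta distribution $\mathrm{B}_{II}(c,d)$ is the probability law on $(0,\infty)$ with density $$\frac{1}{B(c,d)}\,\frac{x^{c-1}}{(1+x)^{c+d}}\,\mathbf 1_{(0,\infty)}(x),$$ where $B$ is the beta function. A random variable is non-Dirac if it is not almost surely constant. $(X,Y)\sim\mu\otimes\nu$ means that $X$ and $Y$ are independent with laws $\mu$ and $\nu$, respectively. *)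

theory Defs
  imports "HOL-Probability.Probability"
begin

text \<open>The map is only meaningful on the open positive quadrant; elsewhere it takes whatever
  value the formula yields.\<close>

definition F_alpha_inf :: "real \<Rightarrow> real \<times> real \<Rightarrow> real \<times> real" where
  "F_alpha_inf \<alpha> = (\<lambda>(x, y).
     ((1 + y + \<alpha> * x * y) / (\<alpha> * x),
      (x * y * (1 + \<alpha> * x)) / (1 + x + y + \<alpha> * x * y)))"

text \<open>The generalized second kind beta distribution is used only for
  \<open>\<gamma> > 0\<close>, \<open>p, q > 0\<close> and \<open>-q < \<nu> < p\<close>, where the unnormalized density is integrable with
  positive integral.\<close>

definition GB_II_kernel :: "real \<Rightarrow> real \<Rightarrow> real \<Rightarrow> real \<Rightarrow> real \<Rightarrow> real" where
  "GB_II_kernel \<nu> p q \<gamma> x =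
     x powr (q + \<nu> - 1) / ((1 + \<gamma> * x) powr (p + \<nu>) * (1 + x) powr (q - \<nu>))
       * indicator {0<..} x"

definition GB_II :: "real \<Rightarrow> real \<Rightarrow> real \<Rightarrow> real \<Rightarrow> real measure" where
  "GB_II \<nu> p q \<gamma> =
     density lborel
       (\<lambda>x. ennreal (GB_II_kernel \<nu> p q \<gamma> x / (LINT t|lborel. GB_II_kernel \<nu> p q \<gamma> t)))"

definition B_II :: "real \<Rightarrow> real \<Rightarrow> real measure" where
  "B_II c d =
     density lborel
       (\<lambda>x. ennreal (1 / Beta c d * (x powr (c - 1) / (1 + x) powr (c + d)) * indicator {0<..} x))"

definition non_Dirac :: "'a measure \<Rightarrow> ('a \<Rightarrow> real) \<Rightarrow> bool" where
  "non_Dirac M X \<longleftrightarrow> \<not> (\<exists>c. AE \<omega> in M. X \<omega> = c)"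

end

theory Submission
  imports Defs
begin

text \<open>
  Write \<open>(U, V)\<close> for the image of \<open>(X, Y)\<close>. The map is an involution, and it is governed by two
  relations that \<open>(X, Y)\<close> and \<open>(U, V)\<close> exchange:
  \<open>1 + U = (1 + \<alpha>X)(1 + Y)/(\<alpha>X)\<close> and \<open>1 + X = (1 + \<alpha>U)(1 + V)/(\<alpha>U)\<close>.
  A triple such as \<open>(X, Y, U)\<close>, with \<open>X, Y\<close> independent and the first relation, is therefore studied
  on its own (locale \<open>coupled_triple\<close>), and each result is used for \<open>(X, Y, U)\<close> and for \<open>(U, V, X)\<close>.

  \<^bold>\<open>The laws of \<open>Y\<close> and \<open>V\<close>.\<close> All the moments
  \<open>h p r = E[(1 + U)\<^bsup>-p\<^esup> (1 + X)\<^bsup>-r\<^esup>]\<close> exist. By the first relation and independence, \<open>h p r\<close> is a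
  mixed moment of \<open>X\<close> alone times the moment \<open>y\<^sub>p = E[(1 + Y)\<^bsup>-p\<^esup>]\<close>; by the second, it is a mixed
  moment of \<open>U\<close> alone times \<open>v\<^sub>r = E[(1 + V)\<^bsup>-r\<^esup>]\<close>. The two functions of \<open>X\<close> whose powers are mixed are algebraically
  dependent, which gives a linear relation between the values of \<open>h\<close> at the corners of a lattice
  square with coefficients in terms of \<open>A\<^sub>p = y\<^sub>p / (y\<^sub>p - y\<^sub>p\<^sub>+\<^sub>1)\<close>; symmetrically there is one in terms of
  \<open>B\<^sub>r = v\<^sub>r / (v\<^sub>r - v\<^sub>r\<^sub>+\<^sub>1)\<close>. The two relations are compatible only if
  \<open>A\<^sub>p\<^sub>+\<^sub>1 - A\<^sub>p = B\<^sub>r\<^sub>+\<^sub>1 - B\<^sub>r\<close> for all \<open>p\<close> and \<open>r\<close> (\<open>increments_agree\<close>). Hence both sequences are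
  affine with the same slope, and the slope is positive because \<open>Y\<close> is non-Dirac. An affine \<open>A\<close> is
  the moment recurrence of a second kind beta law (\<open>B_II_eqI\<close>), so \<open>Y\<close> and \<open>V\<close> have laws
  \<open>B_II c d\<close> and \<open>B_II c e\<close>; the common slope is \<open>1 / c\<close>.

  \<^bold>\<open>The laws of \<open>X\<close> and \<open>U\<close>.\<close> Given \<open>X = x\<close>, the variable \<open>U\<close> is an affine function of \<open>Y\<close>, so it has
  a density; it is \<open>(\<alpha>xu - 1)\<^bsup>c-1\<^esup>\<close> on \<open>\<alpha>xu > 1\<close> times a function of \<open>x\<close> times a function of \<open>u\<close>. The
  same factor appears in the density of \<open>X\<close> given \<open>U = u\<close>. Dividing the joint law of \<open>(X, U)\<close> by this
  factor, and by the appropriate functions of \<open>x\<close> and \<open>u\<close>, leaves a measure which on \<open>\<alpha>xu > 1\<close> is at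
  once of the form \<open>N(dx) du\<close> and of the form \<open>dx N'(du)\<close>, where \<open>N\<close> is the law of \<open>X\<close> divided by the
  kernel of a generalized beta law. Testing on rectangles shows that \<open>N\<close> is a multiple of Lebesgue
  measure, so the law of \<open>X\<close> is the normalized kernel (\<open>X_law\<close>). Exchanging the roles gives \<open>U\<close>.
\<close>

section \<open>Bounded laws and their moments\<close>

text \<open>On a bounded set the Taylor polynomials of the exponential converge uniformly, so the
  characteristic function is the sum of its moment series.\<close>

lemma moments_determine_law:
  assumes M: "real_distribution M" and N: "real_distribution N"
    and bM: "AE x in M. \<bar>x\<bar> \<le> 1" and bN: "AE x in N. \<bar>x\<bar> \<le> 1"
    and eq: "\<And>k. (LINT x|M. x ^ k) = (LINT x|N. x ^ k)"
  shows "M = N"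
proof (rule Levy_uniqueness[OF M N], rule ext)
  fix t
  have approx: "(\<lambda>n. \<Sum>k\<le>n. ((\<i> * t) ^ k / fact k) * (LINT x|L. x ^ k)) \<longlonglongrightarrow> char L t"
    if L: "real_distribution L" and b: "AE x in L. \<bar>x\<bar> \<le> 1" for L
  proof -
    interpret real_distribution L by fact
    have integ: "integrable L (\<lambda>x. x ^ k)" for k
      by (rule integrable_const_bound[where B=1])
        (use b in \<open>auto elim!: eventually_mono simp: power_abs intro!: power_le_one\<close>)
    have le1: "expectation (\<lambda>x. \<bar>x\<bar> ^ k) \<le> 1" for k
    proof -
      have "expectation (\<lambda>x. \<bar>x\<bar> ^ k) \<le> expectation (\<lambda>x. 1)"
        using b integrable_abs[OF integ, of k]
        by (intro integral_mono_AE) (auto elim!: eventually_mono intro!: power_le_one simp: power_abs)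
      then show ?thesis using prob_space by simp
    qed
    define S where "S n = (\<Sum>k\<le>n. ((\<i> * t) ^ k / fact k) * expectation (\<lambda>x. x ^ k))" for n
    have bound: "norm (char L t - S n) \<le> 2 * (\<bar>t\<bar> ^ n / fact n)" for n
    proof -
      have "cmod (char L t - (\<Sum>k\<le>n. ((\<i> * t) ^ k / fact k) * expectation (\<lambda>x. x ^ k)))
          \<le> (2 * \<bar>t\<bar> ^ n / fact n) * expectation (\<lambda>x. \<bar>x\<bar> ^ n)"
        by (rule char_approx1) (rule integ)
      also have "\<dots> \<le> (2 * \<bar>t\<bar> ^ n / fact n) * 1"
        by (intro mult_left_mono le1) simp
      finally show ?thesis by (simp add: S_def)
    qed
    have null: "(\<lambda>n. 2 * (\<bar>t\<bar> ^ n / fact n)) \<longlonglongrightarrow> 0"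
      using tendsto_mult_right[OF summable_LIMSEQ_zero[OF summable_exp[of "\<bar>t\<bar>"]], of 2]
      by (simp add: field_simps)
    have "(\<lambda>n. char L t - S n) \<longlonglongrightarrow> 0"
      by (rule Lim_null_comparison[OF always_eventually null]) (rule allI, rule bound)
    from tendsto_diff[OF tendsto_const[of "char L t"] this] have "S \<longlonglongrightarrow> char L t" by simp
    then show ?thesis unfolding S_def .
  qed
  have "(\<lambda>n. \<Sum>k\<le>n. ((\<i> * t) ^ k / fact k) * (LINT x|N. x ^ k)) \<longlonglongrightarrow> char M t"
    using approx[OF M bM] by (simp add: eq)
  with approx[OF N bN] show "char M t = char N t"
    by (rule LIMSEQ_unique[symmetric])
qed

section \<open>The second kind beta distribution and its reciprocal moments\<close>

lemma Beta_pos: "0 < c \<Longrightarrow> 0 < d \<Longrightarrow> 0 < Beta c (d::real)"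
  by (simp add: Beta_def)

text \<open>The substitution \<open>t = x / (1 + x)\<close> turns this into the beta integral over the unit interval.\<close>

lemma nn_integral_second_kind_beta:
  fixes c d :: real
  assumes c: "c > 0" and d: "d > 0"
  shows "(\<integral>\<^sup>+x. ennreal (x powr (c - 1) / (1 + x) powr (c + d) * indicator {0<..} x) \<partial>lborel) = ennreal (Beta c d)"
proof -
  let ?f = "\<lambda>t::real. t powr (c - 1) * (1 - t) powr (d - 1)"
  let ?g = "\<lambda>x::real. x / (1 + x)" and ?g' = "\<lambda>x::real. 1 / (1 + x)\<^sup>2"
  have inj: "inj_on ?g {0<..}"
    by (rule inj_onI) (simp add: field_simps)
  have img: "?g ` {0<..} = {0<..<1}"
  proof (intro equalityI subsetI)
    fix t :: real assume "t \<in> {0<..<1}"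
    then have "t = ?g (t / (1 - t))" "t / (1 - t) \<in> {0<..}"
      by (auto simp: field_simps)
    then show "t \<in> ?g ` {0<..}" by (rule image_eqI)
  qed auto
  have der: "(?g has_real_derivative ?g' x) (at x within {0<..})" if "x \<in> {0<..}" for x
    using that by (auto intro!: derivative_eq_intros simp: field_simps power2_eq_square)
  have hi: "(?f has_integral Beta c d) {0<..<1}"
    using has_integral_Beta_real[OF c d] by (simp add: has_integral_Icc_iff_Ioo)
  have "?f absolutely_integrable_on {0<..<1}"
    using hi by (intro nonnegative_absolutely_integrable_1) (auto intro: has_integral_integrable)
  then have "((\<lambda>x. \<bar>?g' x\<bar> * ?f (?g x)) absolutely_integrable_on {0<..} \<and>
        integral {0<..} (\<lambda>x. \<bar>?g' x\<bar> * ?f (?g x)) = Beta c d)"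
    using has_absolute_integral_change_of_variables_1'[OF _ der inj, of ?f "Beta c d"] img
      integral_unique[OF hi] by auto
  then have "((\<lambda>x. \<bar>?g' x\<bar> * ?f (?g x)) has_integral Beta c d) {0<..}"
    unfolding has_integral_iff absolutely_integrable_on_def by (elim conjE) (intro conjI)
  moreover have "\<bar>?g' x\<bar> * ?f (?g x) = x powr (c - 1) / (1 + x) powr (c + d)" if "x \<in> {0<..}" for x
  proof -
    have "1 - ?g x = 1 / (1 + x)" using that by (simp add: field_simps)
    moreover have "(1 + x) powr (c + d) = (1 + x) powr (c - 1) * (1 + x) powr (d - 1) * (1 + x)\<^sup>2"
    proof -
      have "(1 + x)\<^sup>2 = (1 + x) powr 2" using that by simp
      then show ?thesis by (simp only: powr_add[symmetric]) simp
    qed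
    ultimately show ?thesis
      using that by (simp add: powr_divide)
  qed
  ultimately have "((\<lambda>x. x powr (c - 1) / (1 + x) powr (c + d)) has_integral Beta c d) {0<..}"
    by (rule has_integral_eq[rotated]) 
  from nn_integral_has_integral_lebesgue'[OF _ this]
  show ?thesis
    by (simp add: ennreal_indicator[symmetric] ennreal_mult''[symmetric] del: ennreal_indicator)
qed

lemma sets_B_II [simp, measurable_cong]: "sets (B_II c d) = sets borel"
  by (simp add: B_II_def)

lemma space_B_II [simp]: "space (B_II c d) = UNIV"
  by (simp add: B_II_def)

lemma AE_B_II_pos: "AE x in B_II c d. 0 < x"
  unfolding B_II_def by (subst AE_density) (auto simp: indicator_def)

lemma nn_integral_B_II_power:
  fixes c d :: real
  assumes c: "c > 0" and d: "d > 0"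
  shows "(\<integral>\<^sup>+x. ennreal ((1 / (1 + x)) ^ n) \<partial>B_II c d) = ennreal (Beta c (d + n) / Beta c d)"
proof -
  have "(\<integral>\<^sup>+x. ennreal ((1 / (1 + x)) ^ n) \<partial>B_II c d) =
      (\<integral>\<^sup>+x. ennreal (1 / Beta c d) *
        ennreal (x powr (c - 1) / (1 + x) powr (c + (d + n)) * indicator {0<..} x) \<partial>lborel)"
    unfolding B_II_def
  proof (subst nn_integral_density; (intro nn_integral_cong)?)
    fix x :: real
    show "ennreal (1 / Beta c d * (x powr (c - 1) / (1 + x) powr (c + d)) * indicator {0<..} x) *
        ennreal ((1 / (1 + x)) ^ n) = ennreal (1 / Beta c d) *
        ennreal (x powr (c - 1) / (1 + x) powr (c + (d + n)) * indicator {0<..} x)"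
    proof (cases "x > 0")
      case True
      then have "(1 + x) powr (c + (d + n)) = (1 + x) powr (c + d) * (1 + x) ^ n"
        by (simp add: powr_add powr_realpow)
      then show ?thesis
        using True Beta_pos[OF c d]
        by (simp add: ennreal_mult''[symmetric] ennreal_mult[symmetric] power_one_over field_simps)
    qed auto
  qed auto
  also have "\<dots> = ennreal (1 / Beta c d) * ennreal (Beta c (d + n))"
    using nn_integral_second_kind_beta[of c "d + n"] c d by (subst nn_integral_cmult) auto
  also have "\<dots> = ennreal (Beta c (d + n) / Beta c d)"
    using Beta_pos[OF c d] Beta_pos[of c "d + n"] c d by (simp add: ennreal_mult[symmetric])
  finally show ?thesis .
qed

lemma real_distribution_B_II:
  assumes "c > 0" "d > 0"
  shows "real_distribution (B_II c d)"
proof -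
  have "prob_space (B_II c d)"
    using nn_integral_B_II_power[OF assms, of 0] Beta_pos[OF assms]
    by (intro prob_spaceI) simp
  then show ?thesis
    by (simp add: real_distribution_def real_distribution_axioms_def)
qed

lemma B_II_moment_recurrence:
  fixes c d :: real
  assumes c: "c > 0" and d: "d > 0"
  shows "(c + d + n) * (LINT x|B_II c d. (1 / (1 + x)) ^ Suc n) =
    (d + n) * (LINT x|B_II c d. (1 / (1 + x)) ^ n)"
proof -
  have val: "(LINT x|B_II c d. (1 / (1 + x)) ^ k) = Beta c (d + k) / Beta c d" for k
    using nn_integral_B_II_power[OF assms, of k] Beta_pos[OF assms] Beta_pos[of c "d + k"] c d
      eventually_mono[OF AE_B_II_pos[of c d], of "\<lambda>x. 0 \<le> (1 / (1 + x)) ^ k"]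
    by (subst integral_eq_nn_integral) auto
  have "(c + (d + n)) * Beta c (d + n + 1) = (d + n) * Beta c (d + n)"
    by (rule Beta_plus1_right) (use d in \<open>auto elim!: nonpos_Ints_cases\<close>)
  then show ?thesis
    by (simp only: val) (simp add: add_ac)
qed

text \<open>The recurrence determines all moments of \<open>1 / (1 + x)\<close> from the total mass, and this variable lies
  in the unit interval, so its law is that obtained from the beta law.\<close>

lemma B_II_eqI:
  fixes c d :: real
  assumes c: "c > 0" and d: "d > 0" and N: "real_distribution N" and pos: "AE x in N. 0 < x"
    and rec: "\<And>n. (c + d + n) * (LINT x|N. (1 / (1 + x)) ^ Suc n) =
      (d + n) * (LINT x|N. (1 / (1 + x)) ^ n)"
  shows "N = B_II c d"
proof -
  let ?s = "\<lambda>x::real. 1 / (1 + x)" and ?t = "\<lambda>y::real. 1 / y - 1"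
  interpret N: real_distribution N by fact
  interpret B: real_distribution "B_II c d" by (rule real_distribution_B_II[OF c d])
  have moments: "(LINT x|N. ?s x ^ n) = (LINT x|B_II c d. ?s x ^ n)" for n
  proof (induction n)
    case 0
    show ?case using N.prob_space B.prob_space by simp
  next
    case (Suc n)
    have "c + d + n > 0" using c d by simp
    then show ?case
      using rec[of n] B_II_moment_recurrence[OF c d, of n] Suc
      by (metis less_irrefl mult_left_cancel)
  qed
  have "distr N borel ?s = distr (B_II c d) borel ?s"
  proof (rule moments_determine_law)
    show "real_distribution (distr N borel ?s)" by (rule N.real_distribution_distr) simp
    show "real_distribution (distr (B_II c d) borel ?s)" by (rule B.real_distribution_distr) simp
    show "AE x in distr N borel ?s. \<bar>x\<bar> \<le> 1"
      using pos by (subst AE_distr_iff) (auto elim!: eventually_mono)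
    show "AE x in distr (B_II c d) borel ?s. \<bar>x\<bar> \<le> 1"
      using AE_B_II_pos[of c d] by (subst AE_distr_iff) (auto elim!: eventually_mono)
    show "(LINT x|distr N borel ?s. x ^ k) = (LINT x|distr (B_II c d) borel ?s. x ^ k)" for k
      using moments[of k] by (simp add: integral_distr)
  qed
  then have "distr (distr N borel ?s) borel ?t = distr (distr (B_II c d) borel ?s) borel ?t"
    by simp
  \<comment> \<open>The map is inverted exactly, even at \<open>x = -1\<close>, because \<open>1 / 0 = 0\<close>.\<close>
  moreover have "distr (distr L borel ?s) borel ?t = L" if "sets L = sets borel" for L :: "real measure"
  proof -
    have [measurable_cong]: "sets L = sets borel" by fact
    have "distr (distr L borel ?s) borel ?t = distr L borel (\<lambda>x. x)"
      by (subst distr_distr) (auto simp: o_def)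
    then show ?thesis by (simp add: distr_id2 that)
  qed
  ultimately show ?thesis by simp
qed

section \<open>Two coupled difference equations\<close>

text \<open>The two equations say first that \<open>A\<^sub>p (h p r - h (p + 1) r) = B\<^sub>r (h p r - h p (r + 1))\<close>. Call a lattice
  function with this property harmonic, and let \<open>D\<close> map it to the common value of the two sides; since
  a weighted difference in \<open>p\<close> commutes with one in \<open>r\<close>, \<open>D\<close> preserves harmonicity. In these terms
  either equation becomes
  \<open>(A\<^sub>p + B\<^sub>r) D h - A\<^sub>p B\<^sub>r h = \<alpha> D h + (1 - \<alpha>) D (D h)\<close>.
  The right-hand side is harmonic. On the left the coefficients depend on the lattice point, and their
  variation contributes exactly \<open>A\<^sub>p B\<^sub>r h (p + 1) (r + 1)\<close> times the difference of the increments of \<open>A\<close>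
  and \<open>B\<close>; as \<open>h\<close> does not vanish, the increments agree. In the proof \<open>g = D h\<close> and \<open>k = D (D h)\<close>.\<close>

lemma increments_agree:
  fixes h :: "nat \<Rightarrow> nat \<Rightarrow> real" and A B :: "nat \<Rightarrow> real" and \<alpha> :: real
  assumes \<alpha>: "\<alpha> > 0" and A: "\<And>p. A p > 0" and B: "\<And>r. B r > 0" and h: "\<And>p r. h p r > 0"
    and eqA: "\<And>p r. (A p - 1) * (h p r - h p (Suc r)) =
      A p * (h (Suc p) r + (1 / \<alpha> - 1) * h (Suc p) (Suc r))"
    and eqB: "\<And>p r. (B r - 1) * (h p r - h (Suc p) r) =
      B r * (h p (Suc r) + (1 / \<alpha> - 1) * h (Suc p) (Suc r))"
  shows "A (Suc p) - A p = B (Suc r) - B r"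
proof -
  define g where "g p r = A p * (h p r - h (Suc p) r)" for p r
  have g': "g p r = B r * (h p r - h p (Suc r))" for p r
  proof -
    have "B r * ((A p - 1) * (h p r - h p (Suc r))) - A p * ((B r - 1) * (h p r - h (Suc p) r))
        = A p * B r * (h (Suc p) r - h p (Suc r))"
      unfolding eqA eqB by algebra
    then show ?thesis unfolding g_def by algebra
  qed
  define k where "k p r = A p * (g p r - g (Suc p) r)" for p r
  have k': "k p r = B r * (g p r - g p (Suc r))" for p r
  proof -
    have "A p * (g p r - g (Suc p) r) = B r * (A p * (h p r - h (Suc p) r) - A p * (h p (Suc r) - h (Suc p) (Suc r)))"
      unfolding g' by algebra
    then show ?thesis unfolding k_def g_def .
  qed
  have k_harmonic: "A p * (k p r - k (Suc p) r) = B r * (k p r - k p (Suc r))" for p r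
  proof -
    have "A p * (k p r - k (Suc p) r) = B r * (A p * (g p r - g (Suc p) r) - A p * (g p (Suc r) - g (Suc p) (Suc r)))"
      unfolding k' by algebra
    then show ?thesis unfolding k_def .
  qed
  define q where "q p r = (A p + B r) * g p r - A p * B r * h p r" for p r
  \<comment> \<open>The values of \<open>h\<close> at the neighbouring lattice points are eliminated in favour of \<open>h\<close>, \<open>g\<close>, \<open>k\<close> at one point.\<close>
  have q: "q p r = \<alpha> * g p r + (1 - \<alpha>) * k p r" for p r
  proof -
    have "\<alpha> * (B r * ((A p - 1) * (h p r - h p (Suc r)))) =
        \<alpha> * (B r * (A p * (h (Suc p) r + (1 / \<alpha> - 1) * h (Suc p) (Suc r))))"
      by (simp only: eqA)
    also have "\<dots> = A p * B r * (\<alpha> * h (Suc p) r + (1 - \<alpha>) * h (Suc p) (Suc r))"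
      using \<alpha> by (simp add: field_simps)
    finally have *: "\<alpha> * (B r * ((A p - 1) * (h p r - h p (Suc r)))) =
      A p * B r * (\<alpha> * h (Suc p) r + (1 - \<alpha>) * h (Suc p) (Suc r))" .
    have "A p * B r * h (Suc p) r = A p * B r * h p r - B r * g p r"
      unfolding g_def by algebra
    moreover have "A p * B r * h (Suc p) (Suc r) = A p * B r * h p r - (A p + B r) * g p r + k p r"
      unfolding k_def g'[of "Suc p" r] unfolding g_def by algebra
    ultimately show ?thesis
      using * g'[of p r] unfolding q_def by algebra
  qed
  have q_harmonic: "A p * (q p r - q (Suc p) r) = B r * (q p r - q p (Suc r))"
    unfolding q
    using k'[of p r] k_def[of p r] k_harmonic[of p r] by algebra
  \<comment> \<open>The same difference for the variable coefficients: a discrete product rule leaves the increment.\<close>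
  have "A p * (q p r - q (Suc p) r) = (A p + B r) * k p r - A p * B r * g p r
      + A p * B r * (A (Suc p) - A p) * h (Suc p) (Suc r)"
    unfolding q_def k_def[of p r] g'[of "Suc p" r] g_def[of p r] by algebra
  moreover have "B r * (q p r - q p (Suc r)) = (A p + B r) * k p r - A p * B r * g p r
      + A p * B r * (B (Suc r) - B r) * h (Suc p) (Suc r)"
    unfolding q_def k'[of p r] g_def[of p "Suc r"] g'[of p r] by algebra
  ultimately have "A p * B r * h (Suc p) (Suc r) * ((A (Suc p) - A p) - (B (Suc r) - B r)) = 0"
    using q_harmonic by algebra
  then show ?thesis
    using A[of p] B[of r] h[of "Suc p" "Suc r"] by simp
qed

section \<open>Moments of a coupled triple\<close>

text \<open>One of the two independent pairs together with one coordinate of the other. Leaving the fourth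
  variable out makes every result about \<open>X, Y, U\<close> available for \<open>U, V, X\<close> as well.\<close>

locale coupled_triple = prob_space M for M :: "'a measure" +
  fixes \<alpha> :: real and X Y U :: "'a \<Rightarrow> real"
  assumes alpha: "\<alpha> > 0"
    and indep: "indep_var borel X borel Y"
    and U_measurable [measurable]: "U \<in> borel_measurable M"
    and pos_X: "AE \<omega> in M. 0 < X \<omega>" and pos_Y: "AE \<omega> in M. 0 < Y \<omega>"
    and coupling: "AE \<omega> in M. 1 + U \<omega> = (1 + \<alpha> * X \<omega>) * (1 + Y \<omega>) / (\<alpha> * X \<omega>)"
begin

lemma X_measurable [measurable]: "X \<in> borel_measurable M"
  and Y_measurable [measurable]: "Y \<in> borel_measurable M"
  using indep by (auto dest: indep_var_rv1 indep_var_rv2)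

definition joint_moment :: "nat \<Rightarrow> nat \<Rightarrow> real" where
  "joint_moment p r = expectation (\<lambda>\<omega>. (1 / (1 + U \<omega>)) ^ p * (1 / (1 + X \<omega>)) ^ r)"

text \<open>Powers of \<open>1 / (1 + Y)\<close> rather than of \<open>Y\<close> are used because they are bounded,
  so that these moments exist for every positive law. The same holds for \<open>joint_moment\<close>.\<close>

definition Y_moment :: "nat \<Rightarrow> real" where
  "Y_moment p = expectation (\<lambda>\<omega>. (1 / (1 + Y \<omega>)) ^ p)"

lemma integrable_Y_power: "integrable M (\<lambda>\<omega>. (1 / (1 + Y \<omega>)) ^ p)"
  by (rule integrable_const_bound[where B=1])
    (use pos_Y in \<open>auto elim!: eventually_mono intro!: power_le_one simp: power_abs\<close>)

lemma integrable_X_powers: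
  "integrable M (\<lambda>\<omega>. (\<alpha> * X \<omega> / (1 + \<alpha> * X \<omega>)) ^ p * (1 / (1 + X \<omega>)) ^ r)"
proof (rule integrable_const_bound[where B=1])
  show "AE \<omega> in M. norm ((\<alpha> * X \<omega> / (1 + \<alpha> * X \<omega>)) ^ p * (1 / (1 + X \<omega>)) ^ r) \<le> 1"
    using pos_X
  proof eventually_elim
    case (elim \<omega>)
    have "0 < \<alpha> * X \<omega>" using elim alpha by simp
    then have "\<bar>\<alpha> * X \<omega> / (1 + \<alpha> * X \<omega>)\<bar> \<le> 1" by (simp add: field_simps)
    moreover have "\<bar>1 / (1 + X \<omega>)\<bar> \<le> 1" using elim by simp
    ultimately show ?case
      unfolding real_norm_def abs_mult power_abs
      by (intro mult_le_one power_le_one) auto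
  qed
qed simp

text \<open>The relation reads \<open>1 / (1 + U) = w / (1 + Y)\<close> with \<open>w = \<alpha>X / (1 + \<alpha>X)\<close>, so the integrand splits into
  a function of \<open>X\<close> and one of \<open>Y\<close>.\<close>

lemma joint_moment_factor:
  "joint_moment p r =
    expectation (\<lambda>\<omega>. (\<alpha> * X \<omega> / (1 + \<alpha> * X \<omega>)) ^ p * (1 / (1 + X \<omega>)) ^ r) * Y_moment p"
proof -
  have "joint_moment p r =
    expectation (\<lambda>\<omega>. ((\<alpha> * X \<omega> / (1 + \<alpha> * X \<omega>)) ^ p * (1 / (1 + X \<omega>)) ^ r) * (1 / (1 + Y \<omega>)) ^ p)"
    unfolding joint_moment_def
  proof (rule integral_cong_AE)
    show "AE \<omega> in M. (1 / (1 + U \<omega>)) ^ p * (1 / (1 + X \<omega>)) ^ r =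
      (\<alpha> * X \<omega> / (1 + \<alpha> * X \<omega>)) ^ p * (1 / (1 + X \<omega>)) ^ r * (1 / (1 + Y \<omega>)) ^ p"
      using coupling
      by eventually_elim (simp add: power_mult_distrib[symmetric] mult_ac)
  qed auto
  also have "\<dots> = expectation (\<lambda>\<omega>. (\<alpha> * X \<omega> / (1 + \<alpha> * X \<omega>)) ^ p * (1 / (1 + X \<omega>)) ^ r) *
      expectation (\<lambda>\<omega>. (1 / (1 + Y \<omega>)) ^ p)"
    by (rule indep_var_lebesgue_integral[OF _ integrable_X_powers integrable_Y_power])
      (rule indep_var_compose[OF indep, unfolded o_def], auto)
  finally show ?thesis by (simp add: Y_moment_def)
qed

lemma Y_moment_0: "Y_moment 0 = 1"
  using prob_space by (simp add: Y_moment_def)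

lemma Y_moment_pos: "Y_moment p > 0"
  unfolding Y_moment_def
  by (rule expectation_greater[OF integrable_Y_power])
    (use pos_Y in \<open>auto elim!: eventually_mono\<close>)

lemma Y_moment_Suc_less: "Y_moment (Suc p) < Y_moment p"
proof -
  have "0 < expectation (\<lambda>\<omega>. (1 / (1 + Y \<omega>)) ^ p - (1 / (1 + Y \<omega>)) ^ Suc p)"
  proof (rule expectation_greater)
    show "AE \<omega> in M. 0 < (1 / (1 + Y \<omega>)) ^ p - (1 / (1 + Y \<omega>)) ^ Suc p"
      using pos_Y
    proof eventually_elim
      case (elim \<omega>)
      define s where "s = 1 / (1 + Y \<omega>)"
      have "0 < s" "s < 1" using elim by (auto simp: s_def)
      then have "0 < s ^ p * (1 - s)" by simp
      then show ?case unfolding s_def[symmetric] by (simp add: algebra_simps)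
    qed
  qed (intro Bochner_Integration.integrable_diff integrable_Y_power)
  then show ?thesis
    unfolding Y_moment_def
    by (simp only: Bochner_Integration.integral_diff integrable_Y_power diff_gt_0_iff_gt)
qed

lemma joint_moment_pos: "joint_moment p r > 0"
proof -
  have "0 < expectation (\<lambda>\<omega>. (\<alpha> * X \<omega> / (1 + \<alpha> * X \<omega>)) ^ p * (1 / (1 + X \<omega>)) ^ r)"
  proof (rule expectation_greater[OF integrable_X_powers])
    show "AE \<omega> in M. 0 < (\<alpha> * X \<omega> / (1 + \<alpha> * X \<omega>)) ^ p * (1 / (1 + X \<omega>)) ^ r"
      using pos_X
    proof eventually_elim
      case (elim \<omega>)
      then have "0 < \<alpha> * X \<omega>" using alpha by simp
      with elim show ?case by simp
    qed
  qed
  then show ?thesis by (simp add: joint_moment_factor Y_moment_pos)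
qed

text \<open>With \<open>w = \<alpha>X / (1 + \<alpha>X)\<close> and \<open>z = 1 / (1 + X)\<close> one has \<open>1 - z = w + (1 / \<alpha> - 1) w z\<close>. Multiplying by
  \<open>w\<^sup>p z\<^sup>r\<close> and taking expectations relates four mixed moments of \<open>X\<close>; passing to \<open>joint_moment\<close> only
  introduces the moments of \<open>Y\<close>.\<close>

lemma joint_moment_relation:
  "Y_moment (Suc p) * (joint_moment p r - joint_moment p (Suc r)) =
    Y_moment p * (joint_moment (Suc p) r + (1 / \<alpha> - 1) * joint_moment (Suc p) (Suc r))"
proof -
  define \<Phi> where
    "\<Phi> p r = expectation (\<lambda>\<omega>. (\<alpha> * X \<omega> / (1 + \<alpha> * X \<omega>)) ^ p * (1 / (1 + X \<omega>)) ^ r)" for p r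
  have "\<Phi> p r - \<Phi> p (Suc r) = expectation (\<lambda>\<omega>. (\<alpha> * X \<omega> / (1 + \<alpha> * X \<omega>)) ^ p * (1 / (1 + X \<omega>)) ^ r -
      (\<alpha> * X \<omega> / (1 + \<alpha> * X \<omega>)) ^ p * (1 / (1 + X \<omega>)) ^ Suc r)"
    unfolding \<Phi>_def by (rule Bochner_Integration.integral_diff[symmetric]; rule integrable_X_powers)
  also have "\<dots> = expectation (\<lambda>\<omega>. (\<alpha> * X \<omega> / (1 + \<alpha> * X \<omega>)) ^ Suc p * (1 / (1 + X \<omega>)) ^ r +
      (1 / \<alpha> - 1) * ((\<alpha> * X \<omega> / (1 + \<alpha> * X \<omega>)) ^ Suc p * (1 / (1 + X \<omega>)) ^ Suc r))"
  proof (rule integral_cong_AE)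
    show "AE \<omega> in M. (\<alpha> * X \<omega> / (1 + \<alpha> * X \<omega>)) ^ p * (1 / (1 + X \<omega>)) ^ r -
        (\<alpha> * X \<omega> / (1 + \<alpha> * X \<omega>)) ^ p * (1 / (1 + X \<omega>)) ^ Suc r =
      (\<alpha> * X \<omega> / (1 + \<alpha> * X \<omega>)) ^ Suc p * (1 / (1 + X \<omega>)) ^ r +
      (1 / \<alpha> - 1) * ((\<alpha> * X \<omega> / (1 + \<alpha> * X \<omega>)) ^ Suc p * (1 / (1 + X \<omega>)) ^ Suc r)"
      using pos_X
    proof eventually_elim
      case (elim \<omega>)
      define w z where "w = \<alpha> * X \<omega> / (1 + \<alpha> * X \<omega>)" and "z = 1 / (1 + X \<omega>)"
      have "0 < \<alpha> * X \<omega>" using elim alpha by simp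
      then have "1 + \<alpha> * X \<omega> \<noteq> 0" by simp
      then have "1 - z = w + (1 / \<alpha> - 1) * (w * z)"
        using elim alpha unfolding w_def z_def by (simp add: divide_simps) algebra
      then have "w ^ p * z ^ r * (1 - z) = w ^ p * z ^ r * (w + (1 / \<alpha> - 1) * (w * z))" by simp
      then show ?case
        unfolding w_def[symmetric] z_def[symmetric] by (simp add: algebra_simps)
    qed
  qed auto
  also have "\<dots> = \<Phi> (Suc p) r + (1 / \<alpha> - 1) * \<Phi> (Suc p) (Suc r)"
    unfolding \<Phi>_def
    by (subst Bochner_Integration.integral_add)
      (intro Bochner_Integration.integrable_mult_right integrable_X_powers
        | simp only: integral_mult_right_zero)+
  finally show ?thesis
    unfolding joint_moment_factor \<Phi>_def[symmetric] by algebra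
qed

text \<open>The reciprocal of the relative drop from one moment to the next. For a second kind beta law this
  is an affine function of \<open>p\<close>, which is why it is preferred to the quotient of the two moments.\<close>

definition recip_drop :: "nat \<Rightarrow> real" where
  "recip_drop p = Y_moment p / (Y_moment p - Y_moment (Suc p))"

lemma recip_drop_gt_1: "recip_drop p > 1"
  using Y_moment_Suc_less[of p] Y_moment_pos[of "Suc p"] by (simp add: recip_drop_def field_simps)

lemma recip_drop_recurrence: "recip_drop p * Y_moment (Suc p) = (recip_drop p - 1) * Y_moment p"
  using Y_moment_Suc_less[of p] by (simp add: recip_drop_def field_simps)

lemma recip_drop_joint_moment:
  "(recip_drop p - 1) * (joint_moment p r - joint_moment p (Suc r)) =
    recip_drop p * (joint_moment (Suc p) r + (1 / \<alpha> - 1) * joint_moment (Suc p) (Suc r))"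
proof -
  have "Y_moment p * ((recip_drop p - 1) * (joint_moment p r - joint_moment p (Suc r))) =
      Y_moment p * (recip_drop p * (joint_moment (Suc p) r + (1 / \<alpha> - 1) * joint_moment (Suc p) (Suc r)))"
    using recip_drop_recurrence[of p] joint_moment_relation[of p r] by algebra
  then show ?thesis using Y_moment_pos[of p] by simp
qed

text \<open>In terms of moments this is \<open>E[S]\<^sup>2 < E[S\<^sup>2]\<close> for \<open>S = 1 / (1 + Y)\<close>: the variance does not vanish.\<close>

lemma recip_drop_0_less_1:
  assumes "non_Dirac M Y"
  shows "recip_drop 0 < recip_drop 1"
proof -
  define S where "S \<omega> = 1 / (1 + Y \<omega>)" for \<omega>
  have int [simp]: "integrable M S" "integrable M (\<lambda>\<omega>. (S \<omega>)\<^sup>2)"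
    using integrable_Y_power[of 1] integrable_Y_power[of 2] by (auto simp: S_def[abs_def])
  have "variance S \<noteq> 0"
  proof
    assume "variance S = 0"
    moreover have "integrable M (\<lambda>\<omega>. (S \<omega> - expectation S)\<^sup>2)"
      unfolding power2_diff by simp
    ultimately have "AE \<omega> in M. (S \<omega> - expectation S)\<^sup>2 = 0"
      by (subst (asm) integral_nonneg_eq_0_iff_AE) auto
    then have "AE \<omega> in M. Y \<omega> = 1 / expectation S - 1"
    proof eventually_elim
      case (elim \<omega>)
      then have "expectation S = 1 / (1 + Y \<omega>)" by (simp add: S_def)
      then show ?case by simp
    qed
    with assms show False unfolding non_Dirac_def by blast
  qed
  then have "variance S > 0" using variance_positive[of S] by linarith
  then have "(Y_moment 1)\<^sup>2 < Y_moment 2"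
    using variance_eq[OF int] by (simp add: Y_moment_def S_def[symmetric])
  then show ?thesis
    using Y_moment_Suc_less[of 0] Y_moment_Suc_less[of 1]
    by (simp add: recip_drop_def Y_moment_0 field_simps power2_eq_square numeral_2_eq_2)
qed

text \<open>For \<open>B_II c d\<close> the reciprocal drop is \<open>(c + d + p) / c\<close>; the parameters are read off from slope and
  initial value.\<close>

lemma Y_law_of_affine_recip_drop:
  assumes \<delta>: "\<delta> > 0" and affine: "\<And>p. recip_drop p = recip_drop 0 + p * \<delta>"
  shows "distr M borel Y = B_II (1 / \<delta>) ((recip_drop 0 - 1) / \<delta>)"
proof (rule B_II_eqI)
  show "real_distribution (distr M borel Y)" by (rule real_distribution_distr) simp
  show "AE x in distr M borel Y. 0 < x" using pos_Y by (simp add: AE_distr_iff)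
  show "(1 / \<delta> + (recip_drop 0 - 1) / \<delta> + n) * (LINT x|distr M borel Y. (1 / (1 + x)) ^ Suc n) =
      ((recip_drop 0 - 1) / \<delta> + n) * (LINT x|distr M borel Y. (1 / (1 + x)) ^ n)" for n
  proof -
    have mom: "(LINT x|distr M borel Y. (1 / (1 + x)) ^ k) = Y_moment k" for k
      by (simp add: integral_distr Y_moment_def)
    have "1 / \<delta> + (recip_drop 0 - 1) / \<delta> + n = recip_drop n / \<delta>"
      "(recip_drop 0 - 1) / \<delta> + n = (recip_drop n - 1) / \<delta>"
      using \<delta> by (simp_all add: affine[of n] field_simps)
    then show ?thesis
      unfolding mom using recip_drop_recurrence[of n] by simp
  qed
qed (use \<delta> recip_drop_gt_1[of 0] in auto)

end

section \<open>The laws of the beta coordinates\<close>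

text \<open>The symmetric situation: exchanging \<open>(X, Y)\<close> and \<open>(U, V)\<close> gives another instance of this locale.\<close>

locale coupled_pair = prob_space M +
  XY: coupled_triple M \<alpha> X Y U + UV: coupled_triple M \<alpha> U V X
  for M :: "'a measure" and \<alpha> :: real and X Y U V
begin

text \<open>The link between the two triples: both see the same moments of \<open>(U, X)\<close>.\<close>

lemma joint_moment_swap: "UV.joint_moment r p = XY.joint_moment p r"
  by (simp add: XY.joint_moment_def UV.joint_moment_def mult.commute)

lemma recip_drop_increments: "XY.recip_drop (Suc p) - XY.recip_drop p = UV.recip_drop (Suc r) - UV.recip_drop r"
  by (rule increments_agree[OF XY.alpha, where h=XY.joint_moment])
    (use XY.recip_drop_gt_1 UV.recip_drop_gt_1 XY.joint_moment_pos XY.recip_drop_joint_moment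
      UV.recip_drop_joint_moment[unfolded joint_moment_swap] in \<open>auto intro: less_trans[OF zero_less_one]\<close>)

text \<open>Comparing all increments of one sequence with a single increment of the other makes both
  constant and equal. The common slope \<open>1 / c\<close> is why the two beta laws share their first parameter.\<close>

lemma beta_laws:
  assumes "non_Dirac M Y"
  obtains c d e where "c > 0" "d > 0" "e > 0"
    "distr M borel Y = B_II c d" "distr M borel V = B_II c e"
proof -
  define \<delta> where "\<delta> = XY.recip_drop 1 - XY.recip_drop 0"
  have \<delta>: "\<delta> > 0" using XY.recip_drop_0_less_1[OF assms] by (simp add: \<delta>_def)
  have incr: "XY.recip_drop (Suc p) - XY.recip_drop p = \<delta>" "UV.recip_drop (Suc p) - UV.recip_drop p = \<delta>" for p
    using recip_drop_increments[of p 0] recip_drop_increments[of 0 p] recip_drop_increments[of 0 0]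
    by (simp_all add: \<delta>_def)
  have "XY.recip_drop p = XY.recip_drop 0 + p * \<delta>" for p
    by (induction p) (use incr(1) in \<open>auto simp: algebra_simps\<close>)
  note Y = XY.Y_law_of_affine_recip_drop[OF \<delta> this]
  have "UV.recip_drop p = UV.recip_drop 0 + p * \<delta>" for p
    by (induction p) (use incr(2) in \<open>auto simp: algebra_simps\<close>)
  note V = UV.Y_law_of_affine_recip_drop[OF \<delta> this]
  show ?thesis
    by (rule that[OF _ _ _ Y V]) (use \<delta> XY.recip_drop_gt_1[of 0] UV.recip_drop_gt_1[of 0] in auto)
qed

end

section \<open>Integrating the weight against a beta law\<close>

lemma GB_II_kernel_pos_eq:
  "x > 0 \<Longrightarrow> GB_II_kernel \<nu> p q \<gamma> x = x powr (q + \<nu> - 1) / ((1 + \<gamma> * x) powr (p + \<nu>) * (1 + x) powr (q - \<nu>))"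
  by (simp add: GB_II_kernel_def)

lemma GB_II_kernel_nonneg: "GB_II_kernel \<nu> p q \<gamma> x \<ge> 0"
  by (simp add: GB_II_kernel_def)

lemma GB_II_kernel_pos: "\<gamma> > 0 \<Longrightarrow> x > 0 \<Longrightarrow> GB_II_kernel \<nu> p q \<gamma> x > 0"
  by (simp add: GB_II_kernel_pos_eq add_pos_pos less_imp_neq[symmetric])

lemma GB_II_kernel_measurable [measurable]: "GB_II_kernel \<nu> p q \<gamma> \<in> borel_measurable borel"
  unfolding GB_II_kernel_def[abs_def] by measurable

text \<open>The left-hand side is the Jacobian \<open>dy/du\<close>, times the beta density at \<open>y\<close>, times the weight that is
  used below. The weight is chosen to cancel the dependence on \<open>u\<close> and to turn the remaining function of
  \<open>x\<close> into the reciprocal of a kernel. Its exponents are exchanged with those of the dual triple when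
  \<open>(x, d)\<close> and \<open>(u, e)\<close> are exchanged.\<close>

lemma weighted_beta_pointwise:
  fixes \<alpha> c d e x u :: real
  assumes \<alpha>: "\<alpha> > 0" and x: "x > 0" and u: "\<alpha> * x * u > 1" and c: "c > 0" and d: "d > 0"
  defines "y \<equiv> (\<alpha> * x * u - 1) / (1 + \<alpha> * x)"
  shows "\<alpha> * x / (1 + \<alpha> * x) * (1 / Beta c d * (y powr (c - 1) / (1 + y) powr (c + d))) *
      ((\<alpha> * x * u - 1) powr (1 - c) * (1 + x) powr (c + e) * (1 + u) powr (c + d)) =
    \<alpha> powr (1 - c - d) / Beta c d / GB_II_kernel ((d - e) / 2) ((d + e) / 2) (c + (d + e) / 2) \<alpha> x"
proof -
  define s m v t where "s = 1 + \<alpha> * x" and "m = \<alpha> * x * u - 1" and "v = 1 + u" and "t = \<alpha> * x"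
  have t: "t > 0" using \<alpha> x by (simp add: t_def)
  have u0: "u > 0" using u t by (metis less_trans t_def zero_less_mult_pos zero_less_one)
  have pos: "s > 0" "m > 0" "v > 0" "1 + x > 0"
    using t u u0 x by (simp_all add: s_def m_def v_def t_def)
  have y: "y = m / s" "1 + y = t * v / s"
    using pos(1) by (simp_all add: y_def m_def s_def t_def v_def field_simps)
  have B: "Beta c d > 0" by (rule Beta_pos[OF c d])
  have "t / s * (y powr (c - 1) / (1 + y) powr (c + d)) * (m powr (1 - c) * (1 + x) powr (c + e) * v powr (c + d)) =
      t powr (1 - c - d) * s powr d * (1 + x) powr (c + e)"
    unfolding y(2) unfolding y(1) using pos t by (simp add: powr_divide powr_mult powr_add powr_diff field_simps)
  also have "\<dots> = \<alpha> powr (1 - c - d) / GB_II_kernel ((d - e) / 2) ((d + e) / 2) (c + (d + e) / 2) \<alpha> x"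
  proof -
    have exps: "c + (d + e) / 2 + (d - e) / 2 = c + d" "(d + e) / 2 + (d - e) / 2 = d"
      "c + (d + e) / 2 - (d - e) / 2 = c + e" by (simp_all add: field_simps)
    show ?thesis
      unfolding GB_II_kernel_pos_eq[OF x] exps s_def[symmetric] using pos t \<alpha> x
      by (simp add: t_def powr_mult powr_diff powr_add field_simps)
  qed
  finally have E: "t / s * (y powr (c - 1) / (1 + y) powr (c + d)) * (m powr (1 - c) * (1 + x) powr (c + e) * v powr (c + d)) =
      \<alpha> powr (1 - c - d) / GB_II_kernel ((d - e) / 2) ((d + e) / 2) (c + (d + e) / 2) \<alpha> x" .
  have "t / s * (1 / Beta c d * (y powr (c - 1) / (1 + y) powr (c + d))) * (m powr (1 - c) * (1 + x) powr (c + e) * v powr (c + d)) =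
      t / s * (y powr (c - 1) / (1 + y) powr (c + d)) * (m powr (1 - c) * (1 + x) powr (c + e) * v powr (c + d)) / Beta c d"
    by simp
  also note E
  finally show ?thesis
    unfolding s_def m_def v_def t_def by simp
qed

text \<open>For fixed \<open>x\<close> the relation makes \<open>u = T y\<close> an affine function of \<open>y\<close>. After the substitution the
  integrand is constant on \<open>J\<close>.\<close>

lemma nn_integral_weighted_beta:
  fixes \<alpha> c d e x :: real
  assumes \<alpha>: "\<alpha> > 0" and x: "x > 0" and c: "c > 0" and d: "d > 0"
    and J [measurable]: "J \<in> sets borel" and u: "\<And>u. u \<in> J \<Longrightarrow> \<alpha> * x * u > 1"
  defines "T \<equiv> \<lambda>y. (1 + \<alpha> * x) * (1 + y) / (\<alpha> * x) - 1"
  shows "(\<integral>\<^sup>+y. indicator J (T y) * ennreal ((\<alpha> * x * T y - 1) powr (1 - c) *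
        (1 + x) powr (c + e) * (1 + T y) powr (c + d)) \<partial>B_II c d) =
    ennreal (\<alpha> powr (1 - c - d) / Beta c d) *
      ennreal (1 / GB_II_kernel ((d - e) / 2) ((d + e) / 2) (c + (d + e) / 2) \<alpha> x) * emeasure lborel J"
proof -
  let ?c = "\<alpha> * x / (1 + \<alpha> * x)" and ?t = "- 1 / (1 + \<alpha> * x)"
  let ?f = "\<lambda>y. 1 / Beta c d * (y powr (c - 1) / (1 + y) powr (c + d)) * indicator {0<..} y"
  let ?w = "\<lambda>u. (\<alpha> * x * u - 1) powr (1 - c) * (1 + x) powr (c + e) * (1 + u) powr (c + d)"
  let ?K = "\<alpha> powr (1 - c - d) / Beta c d / GB_II_kernel ((d - e) / 2) ((d + e) / 2) (c + (d + e) / 2) \<alpha> x"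
  have t: "\<alpha> * x > 0" using \<alpha> x by simp
  then have s: "1 + \<alpha> * x > 0" by simp
  have aff: "?t + ?c * u = (\<alpha> * x * u - 1) / (1 + \<alpha> * x)" for u
    by (simp add: diff_divide_distrib)
  have Tu: "T (?t + ?c * u) = u" for u
  proof -
    have "1 + (?t + ?c * u) = \<alpha> * x * (1 + u) / (1 + \<alpha> * x)"
      unfolding aff using s by (simp add: field_simps)
    moreover have "1 + \<alpha> * x \<noteq> 0" "\<alpha> * x \<noteq> 0" using s t by auto
    ultimately show ?thesis unfolding T_def by simp
  qed
  have [measurable]: "T \<in> borel_measurable borel" unfolding T_def by measurable
  have "(\<integral>\<^sup>+y. indicator J (T y) * ennreal (?w (T y)) \<partial>B_II c d) =
      (\<integral>\<^sup>+y. ennreal (?f y) * (indicator J (T y) * ennreal (?w (T y))) \<partial>lborel)"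
    unfolding B_II_def by (rule nn_integral_density) auto
  also have "\<dots> = ennreal \<bar>?c\<bar> * (\<integral>\<^sup>+u. ennreal (?f (?t + ?c * u)) * (indicator J u * ennreal (?w u)) \<partial>lborel)"
    using t s by (subst nn_integral_real_affine[where c="?c" and t="?t"]) (auto simp only: Tu, auto)
  also have "\<dots> = (\<integral>\<^sup>+u. ennreal ?c * (ennreal (?f (?t + ?c * u)) * (indicator J u * ennreal (?w u))) \<partial>lborel)"
    using t s by (subst nn_integral_cmult[symmetric]) auto
  also have "\<dots> = (\<integral>\<^sup>+u. ennreal ?K * indicator J u \<partial>lborel)"
  proof (rule nn_integral_cong)
    fix v :: real
    show "ennreal ?c * (ennreal (?f (?t + ?c * v)) * (indicator J v * ennreal (?w v))) = ennreal ?K * indicator J v"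
    proof (cases "v \<in> J")
      case True
      have y: "(\<alpha> * x * v - 1) / (1 + \<alpha> * x) > 0" using u[OF True] s by simp
      have "?c * ?f ((\<alpha> * x * v - 1) / (1 + \<alpha> * x)) * ?w v = ?K"
        using weighted_beta_pointwise[OF \<alpha> x u[OF True] c d, of e] y by simp
      then show ?thesis
        unfolding aff using True s t y Beta_pos[OF c d]
        by (simp add: ennreal_mult''[symmetric] ennreal_mult'[symmetric] mult.assoc)
    qed simp
  qed
  also have "\<dots> = ennreal ?K * emeasure lborel J"
    by (simp add: nn_integral_cmult)
  also have "ennreal ?K = ennreal (\<alpha> powr (1 - c - d) / Beta c d) *
      ennreal (1 / GB_II_kernel ((d - e) / 2) ((d + e) / 2) (c + (d + e) / 2) \<alpha> x)"
    using Beta_pos[OF c d] GB_II_kernel_nonneg by (simp add: ennreal_mult[symmetric])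
  finally show ?thesis .
qed

section \<open>Recovering a law from its proportionality to Lebesgue measure\<close>

text \<open>The factors that belong to two values of \<open>s\<close> can be compared on a far away interval of length one, so
  they are equal; then \<open>s\<close> tends to zero.\<close>

lemma locally_Lebesgue_imp_Lebesgue:
  fixes N :: "real measure"
  assumes N [measurable_cong]: "sets N = sets borel"
    and loc: "\<And>s. s > 0 \<Longrightarrow> \<exists>k. \<forall>I \<in> sets borel. I \<subseteq> {s<..} \<longrightarrow> emeasure N I = k * emeasure lborel I"
  shows "\<exists>k. \<forall>I \<in> sets borel. I \<subseteq> {0<..} \<longrightarrow> emeasure N I = k * emeasure lborel I"
proof -
  obtain k where k: "\<And>s I. s > 0 \<Longrightarrow> I \<in> sets borel \<Longrightarrow> I \<subseteq> {s<..} \<Longrightarrow> emeasure N I = k s * emeasure lborel I"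
    using loc by metis
  have k1: "k s = k 1" if "s > 0" for s
  proof -
    let ?I = "{max s 1<..<max s 1 + 1}"
    have "k s * emeasure lborel ?I = emeasure N ?I"
      by (rule k[symmetric, OF that]) auto
    also have "\<dots> = k 1 * emeasure lborel ?I"
      by (rule k) auto
    finally show ?thesis by simp
  qed
  have "emeasure N I = k 1 * emeasure lborel I" if I [measurable]: "I \<in> sets borel" and "I \<subseteq> {0<..}" for I
  proof -
    define S where "S n = I \<inter> {1 / (Suc n)<..}" for n :: nat
    have S [measurable]: "S n \<in> sets borel" for n unfolding S_def by measurable
    have inc: "incseq S"
      unfolding S_def by (auto simp: incseq_def field_simps intro: order.strict_trans1[rotated])
    have Un: "(\<Union>n. S n) = I"
    proof -
      have "\<exists>n. 1 / real (Suc n) < x" if "x \<in> I" for x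
        using that \<open>I \<subseteq> {0<..}\<close> nat_approx_posE[of x] by auto
      then show ?thesis unfolding S_def by auto
    qed
    have NS: "emeasure N (S n) = k 1 * emeasure lborel (S n)" for n
    proof -
      have "emeasure N (S n) = k (1 / real (Suc n)) * emeasure lborel (S n)"
        by (rule k[OF _ S]) (auto simp: S_def)
      also have "k (1 / real (Suc n)) = k 1"
        by (rule k1) simp
      finally show ?thesis .
    qed
    have "emeasure N I = (SUP n. emeasure N (S n))"
    proof -
      have "range S \<subseteq> sets N" unfolding N by (rule image_subsetI) (rule S)
      from SUP_emeasure_incseq[OF this inc] show ?thesis unfolding Un by (rule sym)
    qed
    also have "\<dots> = (SUP n. k 1 * emeasure lborel (S n))"
      by (simp only: NS)
    also have "\<dots> = k 1 * (SUP n. emeasure lborel (S n))"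
      by (rule SUP_mult_left_ennreal[symmetric])
    also have "(SUP n. emeasure lborel (S n)) = emeasure lborel I"
    proof -
      have "range S \<subseteq> sets lborel" unfolding sets_lborel by (rule image_subsetI) (rule S)
      from SUP_emeasure_incseq[OF this inc] show ?thesis unfolding Un .
    qed
    finally show ?thesis .
  qed
  then show ?thesis by blast
qed

text \<open>The constant \<open>k\<close> may a priori be infinite; total mass one forces both it and the integral of \<open>f\<close>
  to be finite and positive.\<close>

lemma density_normalize:
  fixes N :: "real measure" and f :: "real \<Rightarrow> real"
  assumes "prob_space N" and f [measurable]: "f \<in> borel_measurable borel" and nonneg: "\<And>x. f x \<ge> 0"
    and N: "N = density lborel (\<lambda>x. k * ennreal (f x))"
  shows "N = density lborel (\<lambda>x. ennreal (f x / (LINT t|lborel. f t)))"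
proof -
  interpret prob_space N by fact
  let ?Z = "\<integral>\<^sup>+x. ennreal (f x) \<partial>lborel"
  have "1 = emeasure N UNIV" using emeasure_space_1 by (simp add: N)
  also have "\<dots> = k * ?Z"
    unfolding N by (subst emeasure_density) (auto simp: nn_integral_cmult)
  finally have kZ: "k * ?Z = 1" by simp
  then have "?Z \<noteq> 0" "k \<noteq> 0" by auto
  then have "?Z \<noteq> \<infinity>" using kZ by (auto simp: ennreal_mult_top)
  have "(LINT t|lborel. f t) = enn2real ?Z"
    by (rule integral_eq_nn_integral) (auto simp: nonneg)
  moreover define z where "z = enn2real ?Z"
  ultimately have z: "(LINT t|lborel. f t) = z" "?Z = ennreal z" "z > 0"
    using \<open>?Z \<noteq> 0\<close> \<open>?Z \<noteq> \<infinity>\<close> by (auto simp: less_top enn2real_positive_iff zero_less_iff_neq_zero)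
  have "k = ennreal (1 / z)"
  proof -
    have "k * ennreal z * ennreal (1 / z) = ennreal (1 / z)" using kZ z by simp
    then show ?thesis using z(3) by (simp add: mult.assoc ennreal_mult[symmetric])
  qed
  then have "k * ennreal (f x) = ennreal (f x / z)" for x
    using z(3) nonneg by (simp add: ennreal_mult[symmetric])
  then show ?thesis unfolding z(1) using N by simp
qed

section \<open>The laws of the remaining coordinates\<close>

context coupled_triple
begin

text \<open>A rectangle test for the joint law of \<open>(X, U)\<close>, computed by integrating over \<open>Y\<close> first. The integral on
  the left is symmetric under the exchange of the triples, together with \<open>I, J\<close> and \<open>d, e\<close>, while the right-hand side is not: it carries Lebesgue
  measure in the second coordinate.\<close>

lemma weighted_mass:
  assumes Y: "distr M borel Y = B_II c d" and c: "c > 0" and d: "d > 0"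
    and I [measurable]: "I \<in> sets borel" and J [measurable]: "J \<in> sets borel"
    and I_pos: "I \<subseteq> {0<..}" and IJ: "\<And>x u. x \<in> I \<Longrightarrow> u \<in> J \<Longrightarrow> \<alpha> * x * u > 1"
  shows "(\<integral>\<^sup>+\<omega>. indicator I (X \<omega>) * (indicator J (U \<omega>) * ennreal ((\<alpha> * X \<omega> * U \<omega> - 1) powr (1 - c) *
        (1 + X \<omega>) powr (c + e) * (1 + U \<omega>) powr (c + d))) \<partial>M) =
    ennreal (\<alpha> powr (1 - c - d) / Beta c d) *
      emeasure (density (distr M borel X)
        (\<lambda>x. ennreal (1 / GB_II_kernel ((d - e) / 2) ((d + e) / 2) (c + (d + e) / 2) \<alpha> x))) I *
      emeasure lborel J"
    (is "?L = ennreal ?\<kappa> * emeasure (density _ (\<lambda>x. ennreal (1 / ?K x))) I * _")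
proof -
  define T where "T x y = (1 + \<alpha> * x) * (1 + y) / (\<alpha> * x) - 1" for x y
  define w where "w x u = indicator J u * ennreal ((\<alpha> * x * u - 1) powr (1 - c) *
        (1 + x) powr (c + e) * (1 + u) powr (c + d))" for x u
  have [measurable]: "(\<lambda>(x, y). indicator I x * w x (T x y)) \<in> borel_measurable (borel \<Otimes>\<^sub>M borel)"
    unfolding w_def T_def by measurable
  interpret Y: prob_space "distr M borel Y" by (rule prob_space_distr) simp
  have "?L = (\<integral>\<^sup>+\<omega>. (\<lambda>(x, y). indicator I x * w x (T x y)) (X \<omega>, Y \<omega>) \<partial>M)"
  proof (rule nn_integral_cong_AE)
    show "AE \<omega> in M. indicator I (X \<omega>) * (indicator J (U \<omega>) * ennreal ((\<alpha> * X \<omega> * U \<omega> - 1) powr (1 - c) *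
        (1 + X \<omega>) powr (c + e) * (1 + U \<omega>) powr (c + d))) =
      (\<lambda>(x, y). indicator I x * w x (T x y)) (X \<omega>, Y \<omega>)"
      using coupling
    proof eventually_elim
      case (elim \<omega>)
      then have "T (X \<omega>) (Y \<omega>) = U \<omega>" by (simp add: T_def algebra_simps)
      then show ?case by (simp add: w_def)
    qed
  qed
  also have "\<dots> = (\<integral>\<^sup>+z. (\<lambda>(x, y). indicator I x * w x (T x y)) z \<partial>distr M (borel \<Otimes>\<^sub>M borel) (\<lambda>\<omega>. (X \<omega>, Y \<omega>)))"
    by (rule nn_integral_distr[symmetric]) auto
  also have "distr M (borel \<Otimes>\<^sub>M borel) (\<lambda>\<omega>. (X \<omega>, Y \<omega>)) = distr M borel X \<Otimes>\<^sub>M distr M borel Y"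
    using indep unfolding indep_var_distribution_eq by simp
  also have "(\<integral>\<^sup>+z. (\<lambda>(x, y). indicator I x * w x (T x y)) z \<partial>(distr M borel X \<Otimes>\<^sub>M distr M borel Y)) =
      (\<integral>\<^sup>+x. \<integral>\<^sup>+y. indicator I x * w x (T x y) \<partial>distr M borel Y \<partial>distr M borel X)"
    by (subst Y.nn_integral_fst[symmetric]) (auto cong: measurable_cong_sets)
  also have "\<dots> = (\<integral>\<^sup>+x. (ennreal ?\<kappa> * emeasure lborel J) * (ennreal (1 / ?K x) * indicator I x) \<partial>distr M borel X)"
  proof (rule nn_integral_cong)
    fix x
    show "(\<integral>\<^sup>+y. indicator I x * w x (T x y) \<partial>distr M borel Y) =
        (ennreal ?\<kappa> * emeasure lborel J) * (ennreal (1 / ?K x) * indicator I x)"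
    proof (cases "x \<in> I")
      case True
      then have "x > 0" using I_pos by auto
      from nn_integral_weighted_beta[OF alpha this c d J IJ[OF True], of e]
      show ?thesis
        unfolding Y using True by (simp add: w_def T_def mult_ac)
    qed simp
  qed
  also have "\<dots> = (ennreal ?\<kappa> * emeasure lborel J) * emeasure (density (distr M borel X) (\<lambda>x. ennreal (1 / ?K x))) I"
    by (simp add: nn_integral_cmult emeasure_density)
  finally show ?thesis by (simp add: mult_ac)
qed

end

context coupled_pair
begin

text \<open>Two evaluations of the same weighted rectangle integral, from \<open>(X, Y, U)\<close> and from \<open>(U, V, X)\<close>, show
  that the law of \<open>X\<close> divided by the kernel is proportional to Lebesgue measure on \<open>{s<..}\<close>.\<close>

lemma X_law:
  assumes Y: "distr M borel Y = B_II c d" and V: "distr M borel V = B_II c e"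
    and c: "c > 0" and d: "d > 0" and e: "e > 0"
  shows "distr M borel X = GB_II ((d - e) / 2) ((d + e) / 2) (c + (d + e) / 2) \<alpha>"
proof -
  define \<mu> where "\<mu> = distr M borel X"
  define K where "K = GB_II_kernel ((d - e) / 2) ((d + e) / 2) (c + (d + e) / 2) \<alpha>"
  define N where "N = density \<mu> (\<lambda>x. ennreal (1 / K x))"
  have [measurable]: "K \<in> borel_measurable borel" unfolding K_def by measurable
  have \<mu> [measurable_cong]: "sets \<mu> = sets borel" by (simp add: \<mu>_def)
  have N [measurable_cong]: "sets N = sets borel" by (simp add: N_def \<mu>)
  have "\<exists>k. \<forall>I \<in> sets borel. I \<subseteq> {s<..} \<longrightarrow> emeasure N I = k * emeasure lborel I" if s: "s > 0" for s
  proof -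
    \<comment> \<open>An interval of length one such that \<open>I \<times> J\<close> stays in the region \<open>\<alpha>xu > 1\<close> for all \<open>I \<subseteq> {s<..}\<close>.\<close>
    define J where "J = {1 / (\<alpha> * s)<..<1 / (\<alpha> * s) + 1}"
    define \<kappa> where "\<kappa> = \<alpha> powr (1 - c - d) / Beta c d"
    define m where "m = ennreal (\<alpha> powr (1 - c - e) / Beta c e) *
      emeasure (density (distr M borel U)
        (\<lambda>x. ennreal (1 / GB_II_kernel ((e - d) / 2) ((e + d) / 2) (c + (e + d) / 2) \<alpha> x))) J"
    have \<kappa>: "\<kappa> > 0" using Beta_pos[OF c d] XY.alpha by (simp add: \<kappa>_def)
    have as: "\<alpha> * s > 0" using XY.alpha s by simp
    have J: "J \<in> sets borel" "emeasure lborel J = 1" "J \<subseteq> {0<..}"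
      using as by (auto simp: J_def intro: less_trans[of 0 "1 / (\<alpha> * s)"] simp del: zero_less_mult_iff)
    have "emeasure N I = ennreal (1 / \<kappa>) * m * emeasure lborel I"
      if I: "I \<in> sets borel" "I \<subseteq> {s<..}" for I
    proof -
      have IJ: "\<alpha> * x * u > 1" if "x \<in> I" "u \<in> J" for x u
      proof -
        have "1 = \<alpha> * s * (1 / (\<alpha> * s))" using XY.alpha s by simp
        also have "\<dots> < \<alpha> * s * u"
          using that as by (intro mult_strict_left_mono) (auto simp: J_def)
        also have "\<dots> \<le> \<alpha> * x * u"
          using that I(2) J(3) XY.alpha by (intro mult_right_mono mult_left_mono) auto
        finally show ?thesis .
      qed
      have JI: "\<alpha> * u * x > 1" if "u \<in> J" "x \<in> I" for x u
        using IJ[OF that(2,1)] by (simp add: mult_ac)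
      have I_pos: "I \<subseteq> {0<..}" using I(2) s by auto
      have "ennreal \<kappa> * emeasure N I = ennreal \<kappa> * emeasure N I * emeasure lborel J"
        by (simp add: J)
      also have "\<dots> = (\<integral>\<^sup>+\<omega>. indicator I (X \<omega>) * (indicator J (U \<omega>) * ennreal ((\<alpha> * X \<omega> * U \<omega> - 1) powr (1 - c) *
          (1 + X \<omega>) powr (c + e) * (1 + U \<omega>) powr (c + d))) \<partial>M)"
        unfolding \<kappa>_def N_def \<mu>_def K_def
        by (rule XY.weighted_mass[OF Y c d I(1) J(1) I_pos IJ, symmetric])
      also have "\<dots> = (\<integral>\<^sup>+\<omega>. indicator J (U \<omega>) * (indicator I (X \<omega>) * ennreal ((\<alpha> * U \<omega> * X \<omega> - 1) powr (1 - c) *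
          (1 + U \<omega>) powr (c + d) * (1 + X \<omega>) powr (c + e))) \<partial>M)"
        by (simp add: mult_ac)
      also have "\<dots> = m * emeasure lborel I"
        unfolding m_def by (rule UV.weighted_mass[OF V c e J(1) I(1) J(3) JI])
      finally have "ennreal (1 / \<kappa>) * (ennreal \<kappa> * emeasure N I) = ennreal (1 / \<kappa>) * (m * emeasure lborel I)"
        by simp
      moreover have "ennreal (1 / \<kappa>) * ennreal \<kappa> = 1"
        using \<kappa> by (simp add: ennreal_mult[symmetric])
      ultimately show ?thesis by (simp add: mult.assoc[symmetric])
    qed
    then show ?thesis by blast
  qed
  from locally_Lebesgue_imp_Lebesgue[OF N this] obtain k where
    k: "\<And>I. I \<in> sets borel \<Longrightarrow> I \<subseteq> {0<..} \<Longrightarrow> emeasure N I = k * emeasure lborel I"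
    by blast
  \<comment> \<open>The kernel vanishes on the negative half-line, where its reciprocal carries no information; hence the
  restriction.\<close>
  have restr: "density N (indicator {0<..}) = density lborel (\<lambda>x. k * indicator {0<..} x)"
  proof (rule measure_eqI)
    fix A assume "A \<in> sets (density N (indicator {0<..}))"
    then have A [measurable]: "A \<in> sets borel" by (simp add: N)
    have "emeasure (density N (indicator {0<..})) A = emeasure N ({0<..} \<inter> A)"
      by (subst emeasure_density) (auto simp: N indicator_inter_arith[symmetric])
    also have "\<dots> = k * emeasure lborel ({0<..} \<inter> A)"
      by (rule k) auto
    also have "\<dots> = emeasure (density lborel (\<lambda>x. k * indicator {0<..} x)) A"
      by (subst emeasure_density) (auto simp: mult.assoc nn_integral_cmult indicator_inter_arith[symmetric])
    finally show "emeasure (density N (indicator {0<..})) A = emeasure (density lborel (\<lambda>x. k * indicator {0<..} x)) A" .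
  qed (simp add: N)
  have "\<mu> = density \<mu> (\<lambda>_. 1)" by (simp add: density_1)
  also have "\<dots> = density \<mu> (\<lambda>x. ennreal (1 / K x) * (indicator {0<..} x * ennreal (K x)))"
  proof (rule density_cong)
    have "AE x in \<mu>. 0 < x" unfolding \<mu>_def using XY.pos_X by (simp add: AE_distr_iff)
    then show "AE x in \<mu>. 1 = ennreal (1 / K x) * (indicator {0<..} x * ennreal (K x))"
    proof eventually_elim
      case (elim x)
      then have "K x > 0" unfolding K_def by (rule GB_II_kernel_pos[OF XY.alpha])
      then show ?case using elim by (simp add: ennreal_mult[symmetric])
    qed
  qed auto
  also have "\<dots> = density (density N (indicator {0<..})) (\<lambda>x. ennreal (K x))"
    unfolding N_def by (simp add: density_density_eq mult.assoc)
  also have "\<dots> = density lborel (\<lambda>x. k * indicator {0<..} x * ennreal (K x))"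
    unfolding restr by (subst density_density_eq) auto
  also have "\<dots> = density lborel (\<lambda>x. k * ennreal (K x))"
    by (rule density_cong) (auto simp: K_def GB_II_kernel_def indicator_def)
  finally have eq: "\<mu> = density lborel (\<lambda>x. k * ennreal (K x))" .
  have "prob_space \<mu>" unfolding \<mu>_def by (rule prob_space_distr) simp
  from density_normalize[OF this _ _ eq] show ?thesis
    unfolding GB_II_def \<mu>_def K_def by (simp add: GB_II_kernel_nonneg)
qed

end

section \<open>The characterization\<close>

text \<open>Since \<open>1 + \<alpha>u = (1 + x + y + \<alpha>xy) / x\<close> and \<open>1 + v = (1 + x)(1 + y + \<alpha>xy) / (1 + x + y + \<alpha>xy)\<close>, the
  second relation follows by cancellation.\<close>

lemma F_alpha_inf_coupling:
  fixes \<alpha> x y u v :: real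
  assumes \<alpha>: "\<alpha> > 0" and x: "x > 0" and y: "y > 0" and uv: "(u, v) = F_alpha_inf \<alpha> (x, y)"
  shows "u > 0" "v > 0" "1 + u = (1 + \<alpha> * x) * (1 + y) / (\<alpha> * x)"
    "1 + x = (1 + \<alpha> * u) * (1 + v) / (\<alpha> * u)"
proof -
  have t: "\<alpha> * x > 0" "\<alpha> * x * y > 0" using \<alpha> x y by simp_all
  have u: "u = (1 + y + \<alpha> * x * y) / (\<alpha> * x)"
    and v: "v = x * y * (1 + \<alpha> * x) / (1 + x + y + \<alpha> * x * y)"
    using uv by (simp_all add: F_alpha_inf_def)
  have n: "1 + y + \<alpha> * x * y > 0" and D: "1 + x + y + \<alpha> * x * y > 0" using t x y by linarith+
  show "u > 0" unfolding u using t n by (intro divide_pos_pos)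
  show "v > 0" unfolding v using t D x y by (intro divide_pos_pos mult_pos_pos) auto
  show "1 + u = (1 + \<alpha> * x) * (1 + y) / (\<alpha> * x)"
    unfolding u using \<alpha> x by (simp add: field_simps)
  have "1 + \<alpha> * u = (1 + x + y + \<alpha> * x * y) / x"
    unfolding u using \<alpha> x by (simp add: field_simps)
  moreover have "1 + v = (1 + x) * (1 + y + \<alpha> * x * y) / (1 + x + y + \<alpha> * x * y)"
    unfolding v using D by (simp add: divide_simps) algebra
  moreover have "\<alpha> * u = (1 + y + \<alpha> * x * y) / x"
    unfolding u using \<alpha> by simp
  ultimately show "1 + x = (1 + \<alpha> * u) * (1 + v) / (\<alpha> * u)"
    using D n x by simp
qed

theorem theorem3p2:
  fixes M :: "'a measure" and X Y U V :: "'a \<Rightarrow> real" and \<alpha> :: real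
  assumes "\<alpha> > 0"
    and "prob_space M"
    and "X \<in> borel_measurable M" and "Y \<in> borel_measurable M"
    and "AE \<omega> in M. X \<omega> > 0" and "AE \<omega> in M. Y \<omega> > 0"
    and "non_Dirac M X" and "non_Dirac M Y"
    and "prob_space.indep_var M borel X borel Y"
    and "\<And>\<omega>. \<omega> \<in> space M \<Longrightarrow> (U \<omega>, V \<omega>) = F_alpha_inf \<alpha> (X \<omega>, Y \<omega>)"
    and "prob_space.indep_var M borel U borel V"
  shows "\<exists>a b l :: real. b > a \<and> a > \<bar>l\<bar> \<and>
     distr M (borel \<Otimes>\<^sub>M borel) (\<lambda>\<omega>. (X \<omega>, Y \<omega>))
       = GB_II l a b \<alpha> \<Otimes>\<^sub>M B_II (b - a) (a + l) \<and>
     distr M (borel \<Otimes>\<^sub>M borel) (\<lambda>\<omega>. (U \<omega>, V \<omega>))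
       = GB_II (- l) a b \<alpha> \<Otimes>\<^sub>M B_II (b - a) (a - l)"
proof -
  interpret prob_space M by fact
  note indep_XY = assms(9) and indep_UV = assms(11)
  have [measurable]: "U \<in> borel_measurable M" using indep_UV by (rule indep_var_rv1)
  have "AE \<omega> in M. \<omega> \<in> space M" by (rule AE_space)
  with assms(5,6) have all: "AE \<omega> in M. U \<omega> > 0 \<and> V \<omega> > 0 \<and>
      1 + U \<omega> = (1 + \<alpha> * X \<omega>) * (1 + Y \<omega>) / (\<alpha> * X \<omega>) \<and>
      1 + X \<omega> = (1 + \<alpha> * U \<omega>) * (1 + V \<omega>) / (\<alpha> * U \<omega>)"
    by eventually_elim (use F_alpha_inf_coupling[OF assms(1) _ _ assms(10)] in blast)
  interpret P: coupled_pair M \<alpha> X Y U V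
    by unfold_locales (use assms all in \<open>auto elim: eventually_mono\<close>)
  interpret Q: coupled_pair M \<alpha> U V X Y
    by unfold_locales
  obtain c d e where c: "c > 0" and d: "d > 0" and e: "e > 0"
    and Y: "distr M borel Y = B_II c d" and V: "distr M borel V = B_II c e"
    by (rule P.beta_laws[OF assms(8)])
  note X = P.X_law[OF Y V c d e] and U = Q.X_law[OF V Y c e d]
  \<comment> \<open>The solution of \<open>b - a = c\<close>, \<open>a + l = d\<close>, \<open>a - l = e\<close>.\<close>
  define a b l where "a = (d + e) / 2" and "b = c + (d + e) / 2" and "l = (d - e) / 2"
  have par: "b - a = c" "a + l = d" "a - l = e" "- l = (e - d) / 2"
    "(e + d) / 2 = a" "c + (e + d) / 2 = b" "c + a = b"
    by (simp_all add: a_def b_def l_def field_simps)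
  have "b > a" "a > \<bar>l\<bar>" using c d e by (auto simp: a_def b_def l_def)
  moreover have "distr M (borel \<Otimes>\<^sub>M borel) (\<lambda>\<omega>. (X \<omega>, Y \<omega>)) = GB_II l a b \<alpha> \<Otimes>\<^sub>M B_II (b - a) (a + l)"
    using indep_XY X Y unfolding indep_var_distribution_eq par by (simp add: a_def b_def l_def)
  moreover have "distr M (borel \<Otimes>\<^sub>M borel) (\<lambda>\<omega>. (U \<omega>, V \<omega>)) = GB_II (- l) a b \<alpha> \<Otimes>\<^sub>M B_II (b - a) (a - l)"
    using indep_UV U V unfolding indep_var_distribution_eq par by simp
  ultimately show ?thesis by blast
qed

end
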